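(* Let $R=\mathbb{C}[A,B]/(A^3-B^2)=\mathbb{C}[a,b]$, identified with $\mathbb{C}[T^2,T^3]\subseteq\mathbb{C}[T]$ via $a=T^2$, $b=T^3$, and let $S=R[X,Y,Z]/(Z^2-a^2(aX+bY)^2-1)$. Let $D=T^3\partial_X-T^2\partial_Y=b\partial_X-a\partial_Y$ on $S$. Then the kernel $S^D$ is not finitely generated as a $\mathbb{C}$-algebra.
   Context: Here $a,b$ denote the residue classes of $A,B$ in $R$, and $z$ denotes the residue class of $Z$ in $S$, so $S=R[X,Y][z]$ with $z^2=a^2(aX+bY)^2+1$. The derivation $D=b\partial_X-a\partial_Y$ on $S$ is the $\mathbb{C}$-linear derivation of $S$ determined by $D(a)=D(b)=D(z)=0$, $D(X)=b$, $D(Y)=-a$ (it is well defined on the quotient since it sends $aX+bY$ to $0$). The kernel is $S^D=\{s\in S: D(s)=0\}$. *)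

theory Defs
  imports "HOL-Computational_Algebra.Computational_Algebra"
begin

section \<open>Subalgebras, finite generation, derivations\<close>

text \<open>A commutative algebra over a field is a commutative ring together with its structure map
  \<open>\<iota>\<close>, a ring homomorphism from the field; closure under negation follows from \<open>\<iota> (- 1)\<close>.\<close>

definition subalgebra :: "('k::field \<Rightarrow> 's::comm_ring_1) \<Rightarrow> 's set \<Rightarrow> bool" where
  "subalgebra \<iota> A \<longleftrightarrow>
     range \<iota> \<subseteq> A \<and> (\<forall>x\<in>A. \<forall>y\<in>A. x + y \<in> A) \<and> (\<forall>x\<in>A. \<forall>y\<in>A. x * y \<in> A)"

definition finitely_generated_algebra :: "('k::field \<Rightarrow> 's::comm_ring_1) \<Rightarrow> 's set \<Rightarrow> bool" where
  "finitely_generated_algebra \<iota> A \<longleftrightarrow> (\<exists>G. finite G \<and> G \<subseteq> A \<and> A = subalgebra \<iota> hull G)"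

definition derivation :: "('s::comm_ring_1 \<Rightarrow> 's) \<Rightarrow> bool" where
  "derivation d \<longleftrightarrow> (\<forall>x y. d (x + y) = d x + d y) \<and> (\<forall>x y. d (x * y) = d x * y + x * d y)"

lemma subalgebra_hull: "subalgebra \<iota> (subalgebra \<iota> hull G)"
  by (rule hull_in) (simp add: subalgebra_def subset_iff)

lemma derivation_add: "derivation d \<Longrightarrow> d (x + y) = d x + d y"
  and derivation_mult: "derivation d \<Longrightarrow> d (x * y) = d x * y + x * d y"
  by (simp_all add: derivation_def)

lemma derivation_0: "derivation d \<Longrightarrow> d 0 = 0"
  using derivation_add[of d 0 0] by simp

lemma derivation_diff: "derivation d \<Longrightarrow> d (x - y) = d x - d y"
  using derivation_add[of d "x - y" y] by simp

lemma derivation_1: "derivation d \<Longrightarrow> d 1 = 0"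
  using derivation_mult[of d 1 1] by simp

lemma derivation_sum: "derivation d \<Longrightarrow> d (sum f A) = (\<Sum>i\<in>A. d (f i))"
  by (induction A rule: infinite_finite_induct) (simp_all add: derivation_0 derivation_add)

lemma derivation_map_poly:
  assumes d: "derivation d" shows "derivation (map_poly d)"
  unfolding derivation_def
proof (intro conjI allI poly_eqI)
  fix p q :: "'a poly" and n
  note [simp] = coeff_map_poly derivation_0[OF d] derivation_add[OF d]
  show "coeff (map_poly d (p + q)) n = coeff (map_poly d p + map_poly d q) n"
    by simp
  show "coeff (map_poly d (p * q)) n = coeff (map_poly d p * q + p * map_poly d q) n"
    by (simp add: coeff_mult derivation_sum[OF d] derivation_mult[OF d] sum.distrib)
qed

lemma derivation_pderiv: "derivation (pderiv :: 'a::idom poly \<Rightarrow> 'a poly)"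
  by (simp add: derivation_def pderiv_add pderiv_mult algebra_simps)

section \<open>Congruence modulo a principal ideal\<close>

lemma equivp_dvd_diff: "equivp (\<lambda>p q. g dvd p - q)" for g :: "'a::comm_ring_1"
proof (intro equivpI reflpI sympI transpI)
  fix p q r :: 'a
  show "g dvd p - p" by simp
  show "g dvd q - p" if "g dvd p - q"
    using that dvd_minus_iff[of g "p - q"] by simp
  show "g dvd p - r" if "g dvd p - q" "g dvd q - r"
    using dvd_add[OF that] by simp
qed

lemma dvd_diff_eqI: "p = q \<Longrightarrow> g dvd p - q" for g :: "'a::comm_ring_1"
  by simp

lemma dvd_diff_add_cong: "g dvd p - p' \<Longrightarrow> g dvd q - q' \<Longrightarrow> g dvd (p + q) - (p' + q')"
  for g :: "'a::comm_ring_1"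
  by (simp only: add_diff_add) (rule dvd_add)

lemma dvd_diff_mult_cong:
  fixes g :: "'a::comm_ring_1"
  assumes "g dvd p - p'" "g dvd q - q'" shows "g dvd p * q - p' * q'"
proof -
  have "p * q - p' * q' = (p - p') * q + p' * (q - q')" by (simp add: algebra_simps)
  then show ?thesis using assms by simp
qed

lemma dvd_diff_uminus_cong: "g dvd p - p' \<Longrightarrow> g dvd - p - - p'" for g :: "'a::comm_ring_1"
  by (simp only: minus_diff_minus dvd_minus_iff)

lemma dvd_diff_diff_cong: "g dvd p - p' \<Longrightarrow> g dvd q - q' \<Longrightarrow> g dvd (p - q) - (p' - q')"
  for g :: "'a::comm_ring_1"
  using dvd_diff_add_cong[of g p p' "- q" "- q'"] dvd_diff_uminus_cong[of g q q'] by simp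

section \<open>The ring $R = \mathbb{C}[A,B]/(A^3-B^2)$\<close>

text \<open>$\mathbb{C}[A,B]$ is \<^typ>\<open>complex poly poly\<close>, with \<open>A\<close> the inner and \<open>B\<close> the outer variable.\<close>

definition poly_A :: "complex poly poly" where "poly_A = [:[:0, 1:]:]"
definition poly_B :: "complex poly poly" where "poly_B = [:0, 1:]"

quotient_type cusp_ring = "complex poly poly" / "\<lambda>p q. poly_A ^ 3 - poly_B ^ 2 dvd p - q"
  by (rule equivp_dvd_diff)

text \<open>Evaluation $A \mapsto T^2$, $B \mapsto T^3$.\<close>

definition eval_T :: "complex poly poly \<Rightarrow> complex poly" where
  "eval_T p = poly (map_poly (\<lambda>q. pcompose q (monom 1 2)) p) (monom 1 3)"

lemma eval_T_0: "eval_T 0 = 0"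
  by (simp add: eval_T_def)

lemma eval_T_pCons: "eval_T (pCons c p) = pcompose c (monom 1 2) + monom 1 3 * eval_T p"
  by (simp add: eval_T_def map_poly_pCons)

lemma eval_T_add: "eval_T (p + q) = eval_T p + eval_T q"
  by (induction p q rule: poly_induct2) (simp_all add: eval_T_0 eval_T_pCons pcompose_add algebra_simps)

lemma eval_T_smult: "eval_T (smult c p) = pcompose c (monom 1 2) * eval_T p"
  by (induction p) (simp_all add: eval_T_0 eval_T_pCons pcompose_mult algebra_simps)

lemma eval_T_mult: "eval_T (p * q) = eval_T p * eval_T q"
  by (induction p)
    (simp_all add: eval_T_0 eval_T_pCons eval_T_add eval_T_smult algebra_simps)

lemma eval_T_diff: "eval_T (p - q) = eval_T p - eval_T q"
  using eval_T_add[of "p - q" q] by simp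

lemma eval_T_1: "eval_T 1 = 1"
  by (simp add: eval_T_def pcompose_1)

lemma eval_T_A: "eval_T poly_A = monom 1 2"
  by (simp add: poly_A_def eval_T_pCons eval_T_0 pcompose_pCons)

lemma eval_T_B: "eval_T poly_B = monom 1 3"
  by (simp add: pcompose_1 poly_B_def eval_T_pCons eval_T_0 pcompose_pCons)

lemma eval_T_cusp: "eval_T (poly_A ^ 3 - poly_B ^ 2) = 0"
  by (simp add: eval_T_diff power2_eq_square power3_eq_cube eval_T_mult eval_T_A eval_T_B mult_monom)

lemma eval_T_eq_0_iff: "eval_T p = 0 \<longleftrightarrow> poly_A ^ 3 - poly_B ^ 2 dvd p"
proof
  assume "poly_A ^ 3 - poly_B ^ 2 dvd p"
  then show "eval_T p = 0"
    by (auto simp: dvd_def eval_T_mult eval_T_cusp)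
next
  define g where "g = [:- ([:0, 1:] ^ 3), 0, 1 :: complex poly:]"
  have g: "g = - (poly_A ^ 3 - poly_B ^ 2)"
    by (simp add: g_def poly_A_def poly_B_def power2_eq_square power3_eq_cube)
  assume p0: "eval_T p = 0"
  obtain q r where qr: "pseudo_divmod p g = (q, r)" by fastforce
  have g0: "g \<noteq> 0" "degree g = 2" "lead_coeff g = 1" by (simp_all add: g_def)
  have p: "p = g * q + r" and r: "r = 0 \<or> degree r < 2"
    using pseudo_divmod[OF g0(1) qr] g0 by simp_all
  obtain u v where uv: "r = [:u, v:]"
  proof -
    have "r = [:coeff r 0, coeff r 1:]"
      using r by (intro poly_eqI) (auto simp: coeff_pCons coeff_eq_0 split: nat.split)
    then show thesis by (rule that)
  qed
  define u' v' where "u' = pcompose u (monom 1 2)" and "v' = monom 1 3 * pcompose v (monom (1::complex) 2)"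
  have dm: "degree (monom (1::complex) 2) = 2" "degree (monom (1::complex) 3) = 3"
    by (simp_all add: degree_monom_eq)
  have "eval_T g = 0"
    using eval_T_cusp eval_T_diff[of 0 "poly_A ^ 3 - poly_B ^ 2"] by (simp add: g eval_T_0)
  then have "eval_T r = 0"
    using p0 by (simp add: p eval_T_add eval_T_mult)
  then have s: "u' + v' = 0"
    by (simp add: uv eval_T_pCons eval_T_0 u'_def v'_def)
  have v: "v = 0"
  proof (rule ccontr)
    assume "v \<noteq> 0"
    then have "pcompose v (monom 1 2) \<noteq> 0"
      using pcompose_eq_0[of v "monom 1 2"] dm by auto
    then have "degree v' = 3 + 2 * degree v"
      by (simp add: v'_def degree_mult_eq dm degree_pcompose)
    moreover have "degree u' = 2 * degree u"
      by (simp add: u'_def dm degree_pcompose)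
    moreover have "degree u' = degree v'"
      using s by (metis degree_minus add_eq_0_iff)
    ultimately show False by presburger
  qed
  then have "u = 0"
    using s pcompose_eq_0[of u "monom 1 2"] dm by (auto simp: u'_def v'_def)
  then have "p = g * q" by (simp add: p uv v)
  then have "g dvd p" by simp
  then show "poly_A ^ 3 - poly_B ^ 2 dvd p" by (simp only: g minus_dvd_iff)
qed

lemma eval_T_eq_iff: "eval_T p = eval_T q \<longleftrightarrow> poly_A ^ 3 - poly_B ^ 2 dvd p - q"
  using eval_T_eq_0_iff[of "p - q"] by (simp add: eval_T_diff)

instantiation cusp_ring :: comm_ring_1
begin
lift_definition zero_cusp_ring :: cusp_ring is 0 .
lift_definition one_cusp_ring :: cusp_ring is 1 .
lift_definition plus_cusp_ring :: "cusp_ring \<Rightarrow> cusp_ring \<Rightarrow> cusp_ring" is "(+)"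
  by (rule dvd_diff_add_cong)
lift_definition minus_cusp_ring :: "cusp_ring \<Rightarrow> cusp_ring \<Rightarrow> cusp_ring" is "(-)"
  by (rule dvd_diff_diff_cong)
lift_definition uminus_cusp_ring :: "cusp_ring \<Rightarrow> cusp_ring" is uminus
  by (rule dvd_diff_uminus_cong)
lift_definition times_cusp_ring :: "cusp_ring \<Rightarrow> cusp_ring \<Rightarrow> cusp_ring" is "(*)"
  by (rule dvd_diff_mult_cong)
instance
proof
  show "(0::cusp_ring) \<noteq> 1"
    by transfer (simp add: eval_T_eq_0_iff[symmetric] eval_T_diff eval_T_0 eval_T_1)
  fix a b c :: cusp_ring
  show "a * b * c = a * (b * c)"
    by (transfer, rule dvd_diff_eqI) (simp add: algebra_simps)
  show "a * b = b * a"
    by (transfer, rule dvd_diff_eqI) (simp add: algebra_simps)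
  show "1 * a = a"
    by (transfer, rule dvd_diff_eqI) (simp add: algebra_simps)
  show "a + b + c = a + (b + c)"
    by (transfer, rule dvd_diff_eqI) (simp add: algebra_simps)
  show "a + b = b + a"
    by (transfer, rule dvd_diff_eqI) (simp add: algebra_simps)
  show "0 + a = a"
    by (transfer, rule dvd_diff_eqI) (simp add: algebra_simps)
  show "- a + a = 0"
    by (transfer, rule dvd_diff_eqI) (simp add: algebra_simps)
  show "a - b = a + - b"
    by (transfer, rule dvd_diff_eqI) (simp add: algebra_simps)
  show "(a + b) * c = a * c + b * c"
    by (transfer, rule dvd_diff_eqI) (simp add: algebra_simps)
qed
end

text \<open>The identification of $R$ with $\mathbb{C}[T^2,T^3] \subseteq \mathbb{C}[T]$.\<close>

lift_definition cusp_to_T :: "cusp_ring \<Rightarrow> complex poly" is eval_T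
  by (rule eval_T_eq_iff[THEN iffD2])

lemma cusp_to_T_add: "cusp_to_T (x + y) = cusp_to_T x + cusp_to_T y"
  by transfer (rule eval_T_add)

lemma cusp_to_T_mult: "cusp_to_T (x * y) = cusp_to_T x * cusp_to_T y"
  by transfer (rule eval_T_mult)

lemma cusp_to_T_0: "cusp_to_T 0 = 0"
  by transfer (rule eval_T_0)

lemma cusp_to_T_1: "cusp_to_T 1 = 1"
  by transfer (rule eval_T_1)

lemma inj_cusp_to_T: "inj cusp_to_T"
  by (rule injI, transfer) (rule eval_T_eq_iff[THEN iffD1])

lemma cusp_to_T_eq_0_iff: "cusp_to_T x = 0 \<longleftrightarrow> x = 0"
  using inj_eq[OF inj_cusp_to_T, of x 0] by (simp add: cusp_to_T_0)

text \<open>That $R$ is a domain is needed because the library's \<^const>\<open>pderiv\<close> requires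
  coefficients without zero divisors.\<close>

instance cusp_ring :: idom
proof
  fix x y :: cusp_ring
  assume "x \<noteq> 0" "y \<noteq> 0"
  then show "x * y \<noteq> 0"
    by (simp add: cusp_to_T_eq_0_iff[symmetric] cusp_to_T_mult)
qed

lift_definition cusp_const :: "complex \<Rightarrow> cusp_ring" is "\<lambda>c. [:[:c:]:]" .
lift_definition cusp_a :: cusp_ring is poly_A .
lift_definition cusp_b :: cusp_ring is poly_B .

lemma cusp_relation: "cusp_a ^ 3 = cusp_b ^ 2"
  unfolding power2_eq_square power3_eq_cube
  by transfer (simp add: power2_eq_square power3_eq_cube)

lemma cusp_const_hom:
  "cusp_const (c + d) = cusp_const c + cusp_const d"
  "cusp_const (c * d) = cusp_const c * cusp_const d"
  "cusp_const 0 = 0" "cusp_const 1 = 1"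
  by (transfer; simp add: one_pCons)+

lemma cusp_to_T_gens:
  "cusp_to_T cusp_a = monom 1 2" "cusp_to_T cusp_b = monom 1 3" "cusp_to_T (cusp_const c) = [:c:]"
  by (transfer; simp add: eval_T_A eval_T_B eval_T_pCons eval_T_0)+

lemma cusp_generated:
  assumes A: "subalgebra cusp_const A" "cusp_a \<in> A" "cusp_b \<in> A"
  shows "x \<in> A"
proof -
  have plus: "\<And>x y. x \<in> A \<Longrightarrow> y \<in> A \<Longrightarrow> x + y \<in> A"
    and times: "\<And>x y. x \<in> A \<Longrightarrow> y \<in> A \<Longrightarrow> x * y \<in> A" and const: "\<And>c. cusp_const c \<in> A"
    using A(1) by (auto simp: subalgebra_def)
  have inner: "abs_cusp_ring [:q:] \<in> A" for q
  proof (induction q)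
    case 0
    then show ?case using const[of 0] by (simp add: cusp_const.abs_eq)
  next
    case (pCons c q)
    have "[:pCons c q:] = [:[:c:]:] + poly_A * [:q:]" by (simp add: poly_A_def)
    then have "abs_cusp_ring [:pCons c q:] = cusp_const c + cusp_a * abs_cusp_ring [:q:]"
      by (simp add: cusp_const.abs_eq cusp_a.abs_eq plus_cusp_ring.abs_eq times_cusp_ring.abs_eq)
    then show ?case using plus times const A pCons by simp
  qed
  have "abs_cusp_ring p \<in> A" for p
  proof (induction p)
    case 0
    then show ?case using inner[of 0] by simp
  next
    case (pCons c q)
    have "pCons c q = [:c:] + poly_B * q" by (simp add: poly_B_def)
    then have "abs_cusp_ring (pCons c q) = abs_cusp_ring [:c:] + cusp_b * abs_cusp_ring q"
      by (simp only: cusp_b.abs_eq plus_cusp_ring.abs_eq times_cusp_ring.abs_eq)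
    then show ?case using plus times inner A pCons by simp
  qed
  then show ?thesis by (induction x rule: cusp_ring.abs_induct)
qed

lemma range_cusp_to_T: "range cusp_to_T = subalgebra (\<lambda>c. [:c:]) hull {monom 1 2, monom 1 3}"
  (is "_ = ?H")
proof
  have H: "subalgebra (\<lambda>c. [:c:]) ?H" by (rule subalgebra_hull)
  have gens: "{monom 1 2, monom 1 3} \<subseteq> ?H" by (rule hull_subset)
  have "x \<in> {x. cusp_to_T x \<in> ?H}" for x
    by (rule cusp_generated) (use H gens in \<open>auto simp: subalgebra_def cusp_to_T_gens cusp_to_T_add cusp_to_T_mult\<close>)
  then show "range cusp_to_T \<subseteq> ?H" by auto
  have rng: "p \<in> range cusp_to_T" if "cusp_to_T r = p" for p r
    using that by auto
  show "?H \<subseteq> range cusp_to_T"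
  proof (rule hull_minimal)
    show "{monom 1 2, monom 1 3} \<subseteq> range cusp_to_T"
      by (simp add: rng[OF cusp_to_T_gens(1)] rng[OF cusp_to_T_gens(2)])
    show "subalgebra (\<lambda>c. [:c:]) (range cusp_to_T)"
      by (auto simp: subalgebra_def
          intro: rng[OF cusp_to_T_gens(3)] rng[OF cusp_to_T_add] rng[OF cusp_to_T_mult])
  qed
qed

section \<open>The ring $S = R[X,Y,Z]/(Z^2-a^2(aX+bY)^2-1)$\<close>

text \<open>$R[X,Y,Z]$ is \<^typ>\<open>cusp_ring poly poly poly\<close>, with \<open>X\<close> the innermost and \<open>Z\<close> the
  outermost variable.\<close>

abbreviation R_const :: "cusp_ring \<Rightarrow> cusp_ring poly poly poly" where
  "R_const r \<equiv> [:[:[:r:]:]:]"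

definition poly_X :: "cusp_ring poly poly poly" where "poly_X = [:[:[:0, 1:]:]:]"
definition poly_Y :: "cusp_ring poly poly poly" where "poly_Y = [:[:0, 1:]:]"
definition poly_Z :: "cusp_ring poly poly poly" where "poly_Z = [:0, 1:]"

definition S_relator :: "cusp_ring poly poly poly" where
  "S_relator = poly_Z ^ 2
     - R_const cusp_a ^ 2 * (R_const cusp_a * poly_X + R_const cusp_b * poly_Y) ^ 2 - 1"

quotient_type S_ring = "cusp_ring poly poly poly" / "\<lambda>p q. S_relator dvd p - q"
  by (rule equivp_dvd_diff)

lemma degree_S_relator: "degree S_relator = 2"
proof -
  obtain c where c: "S_relator = [:c, 0, 1:]"
  proof
    show "S_relator = [:- ([:[:cusp_a:]:] ^ 2 * ([:[:cusp_a:] * [:0, 1:]:] + [:[:cusp_b:]:] * [:0, 1:]) ^ 2) - 1, 0, 1:]"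
      by (simp add: S_relator_def poly_X_def poly_Y_def poly_Z_def power2_eq_square one_pCons)
  qed
  show ?thesis unfolding c by simp
qed

instantiation S_ring :: comm_ring_1
begin
lift_definition zero_S_ring :: S_ring is 0 .
lift_definition one_S_ring :: S_ring is 1 .
lift_definition plus_S_ring :: "S_ring \<Rightarrow> S_ring \<Rightarrow> S_ring" is "(+)"
  by (rule dvd_diff_add_cong)
lift_definition minus_S_ring :: "S_ring \<Rightarrow> S_ring \<Rightarrow> S_ring" is "(-)"
  by (rule dvd_diff_diff_cong)
lift_definition uminus_S_ring :: "S_ring \<Rightarrow> S_ring" is uminus
  by (rule dvd_diff_uminus_cong)
lift_definition times_S_ring :: "S_ring \<Rightarrow> S_ring \<Rightarrow> S_ring" is "(*)"
  by (rule dvd_diff_mult_cong)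
instance
proof
  show "(0::S_ring) \<noteq> 1"
  proof (transfer, rule notI)
    assume "S_relator dvd 0 - 1"
    then have "S_relator dvd 1" by simp
    then have "degree S_relator \<le> degree (1 :: cusp_ring poly poly poly)"
      by (rule dvd_imp_degree_le) simp
    then show False by (simp add: degree_S_relator)
  qed
  fix a b c :: S_ring
  show "a * b * c = a * (b * c)"
    by (transfer, rule dvd_diff_eqI) (simp add: algebra_simps)
  show "a * b = b * a"
    by (transfer, rule dvd_diff_eqI) (simp add: algebra_simps)
  show "1 * a = a"
    by (transfer, rule dvd_diff_eqI) (simp add: algebra_simps)
  show "a + b + c = a + (b + c)"
    by (transfer, rule dvd_diff_eqI) (simp add: algebra_simps)
  show "a + b = b + a"
    by (transfer, rule dvd_diff_eqI) (simp add: algebra_simps)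
  show "0 + a = a"
    by (transfer, rule dvd_diff_eqI) (simp add: algebra_simps)
  show "- a + a = 0"
    by (transfer, rule dvd_diff_eqI) (simp add: algebra_simps)
  show "a - b = a + - b"
    by (transfer, rule dvd_diff_eqI) (simp add: algebra_simps)
  show "(a + b) * c = a * c + b * c"
    by (transfer, rule dvd_diff_eqI) (simp add: algebra_simps)
qed
end

lift_definition R_to_S :: "cusp_ring \<Rightarrow> S_ring" is R_const .
lift_definition S_X :: S_ring is poly_X .
lift_definition S_Y :: S_ring is poly_Y .
lift_definition S_z :: S_ring is poly_Z .

definition S_const :: "complex \<Rightarrow> S_ring" where "S_const c = R_to_S (cusp_const c)"
definition S_a :: S_ring where "S_a = R_to_S cusp_a"
definition S_b :: S_ring where "S_b = R_to_S cusp_b"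

lemma R_to_S_hom:
  "R_to_S (x + y) = R_to_S x + R_to_S y" "R_to_S (x * y) = R_to_S x * R_to_S y"
  "R_to_S 0 = 0" "R_to_S 1 = 1"
  by (transfer; simp add: one_pCons)+

lemma S_const_hom:
  "S_const (c + d) = S_const c + S_const d" "S_const (c * d) = S_const c * S_const d"
  "S_const 0 = 0" "S_const 1 = 1"
  by (simp_all add: S_const_def cusp_const_hom R_to_S_hom)

lemma S_relation: "S_z ^ 2 = S_a ^ 2 * (S_a * S_X + S_b * S_Y) ^ 2 + 1"
  by (simp only: S_a_def S_b_def power2_eq_square S_ring.abs_eq_iff R_to_S.abs_eq S_X.abs_eq S_Y.abs_eq
      S_z.abs_eq one_S_ring.abs_eq plus_S_ring.abs_eq times_S_ring.abs_eq)
    (simp only: S_relator_def power2_eq_square diff_diff_eq dvd_refl)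

lemma S_generated:
  assumes A: "subalgebra S_const A" "S_a \<in> A" "S_b \<in> A" "S_X \<in> A" "S_Y \<in> A" "S_z \<in> A"
  shows "s \<in> A"
proof -
  have plus: "\<And>x y. x \<in> A \<Longrightarrow> y \<in> A \<Longrightarrow> x + y \<in> A"
    and times: "\<And>x y. x \<in> A \<Longrightarrow> y \<in> A \<Longrightarrow> x * y \<in> A" and const: "\<And>c. S_const c \<in> A"
    using A(1) by (auto simp: subalgebra_def)
  note abs = plus_S_ring.abs_eq times_S_ring.abs_eq
  have R: "abs_S_ring (R_const r) \<in> A" for r
  proof -
    have "r \<in> {r. R_to_S r \<in> A}"
      by (rule cusp_generated)
        (use A plus times const in \<open>auto simp: subalgebra_def R_to_S_hom S_const_def S_a_def S_b_def\<close>)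
    then show ?thesis by (simp add: R_to_S.abs_eq)
  qed
  have X: "abs_S_ring [:[:q:]:] \<in> A" for q
  proof (induction q)
    case 0
    then show ?case using R[of 0] by simp
  next
    case (pCons c q)
    have "[:[:pCons c q:]:] = R_const c + poly_X * [:[:q:]:]" by (simp add: poly_X_def)
    then have "abs_S_ring [:[:pCons c q:]:] = abs_S_ring (R_const c) + S_X * abs_S_ring [:[:q:]:]"
      by (simp only: S_X.abs_eq abs)
    then show ?case using plus times R A pCons by simp
  qed
  have Y: "abs_S_ring [:q:] \<in> A" for q
  proof (induction q)
    case 0
    then show ?case using R[of 0] by simp
  next
    case (pCons c q)
    have "[:pCons c q:] = [:[:c:]:] + poly_Y * [:q:]" by (simp add: poly_Y_def)
    then have "abs_S_ring [:pCons c q:] = abs_S_ring [:[:c:]:] + S_Y * abs_S_ring [:q:]"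
      by (simp only: S_Y.abs_eq abs)
    then show ?case using plus times X A pCons by simp
  qed
  have "abs_S_ring p \<in> A" for p
  proof (induction p)
    case 0
    then show ?case using R[of 0] by simp
  next
    case (pCons c q)
    have "pCons c q = [:c:] + poly_Z * q" by (simp add: poly_Z_def)
    then have "abs_S_ring (pCons c q) = abs_S_ring [:c:] + S_z * abs_S_ring q"
      by (simp only: S_z.abs_eq abs)
    then show ?case using plus times Y A pCons by simp
  qed
  then show ?thesis by (induction s rule: S_ring.abs_induct)
qed

section \<open>The derivation $D = b\,\partial_X - a\,\partial_Y$\<close>

definition partial_X :: "cusp_ring poly poly poly \<Rightarrow> cusp_ring poly poly poly" where
  "partial_X = map_poly (map_poly pderiv)"

definition partial_Y :: "cusp_ring poly poly poly \<Rightarrow> cusp_ring poly poly poly" where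
  "partial_Y = map_poly pderiv"

definition poly_D :: "cusp_ring poly poly poly \<Rightarrow> cusp_ring poly poly poly" where
  "poly_D p = R_const cusp_b * partial_X p - R_const cusp_a * partial_Y p"

lemma derivation_poly_D: "derivation poly_D"
proof -
  have "derivation partial_X" "derivation partial_Y"
    by (simp_all add: partial_X_def partial_Y_def derivation_map_poly derivation_pderiv)
  note this[THEN derivation_add] this[THEN derivation_mult]
  then show ?thesis
    unfolding derivation_def poly_D_def by (simp add: algebra_simps del: mult_pCons_left mult_pCons_right)
qed

lemma poly_D_gens:
  "poly_D (R_const r) = 0" "poly_D poly_X = R_const cusp_b" "poly_D poly_Y = - R_const cusp_a"
  "poly_D poly_Z = 0"
  by (simp_all add: poly_D_def partial_X_def partial_Y_def poly_X_def poly_Y_def poly_Z_def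
      map_poly_pCons pderiv_pCons one_pCons)

lemma poly_D_relator: "poly_D S_relator = 0"
proof -
  note D = derivation_add[OF derivation_poly_D] derivation_mult[OF derivation_poly_D]
    derivation_diff[OF derivation_poly_D] derivation_1[OF derivation_poly_D] poly_D_gens
  have "poly_D (R_const cusp_a * poly_X + R_const cusp_b * poly_Y) = 0"
    by (simp only: D) (simp add: mult.commute)
  then show ?thesis
    by (simp only: S_relator_def power2_eq_square D) simp
qed

lift_definition S_D :: "S_ring \<Rightarrow> S_ring" is poly_D
proof -
  fix p q :: "cusp_ring poly poly poly"
  assume "S_relator dvd p - q"
  then obtain k where "p - q = S_relator * k" by (auto simp: dvd_def)
  then have "poly_D p - poly_D q = S_relator * poly_D k"
    by (metis add_0 derivation_diff derivation_mult derivation_poly_D mult_zero_left poly_D_relator)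
  then show "S_relator dvd poly_D p - poly_D q" by simp
qed

lemma derivation_S_D: "derivation S_D"
  unfolding derivation_def
  by (intro conjI allI; transfer)
    (simp_all add: derivation_add[OF derivation_poly_D] derivation_mult[OF derivation_poly_D])

lemma S_D_R_to_S: "S_D (R_to_S r) = 0"
  by transfer (simp add: poly_D_gens(1))

lemma S_D_gens:
  "S_D (S_const c) = 0" "S_D S_a = 0" "S_D S_b = 0" "S_D S_z = 0" "S_D S_X = S_b" "S_D S_Y = - S_a"
  unfolding S_const_def S_a_def S_b_def
  by (simp_all add: S_D_R_to_S) (transfer; simp add: poly_D_gens)+

lemma S_D_linear: "S_D (S_const c * s) = S_const c * S_D s"
  by (simp add: derivation_mult[OF derivation_S_D] S_D_gens)

text \<open>\<^const>\<open>S_D\<close> is the only derivation with these values.\<close>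

lemma S_D_unique:
  assumes E: "derivation E" "\<And>c. E (S_const c) = 0" "E S_a = 0" "E S_b = 0" "E S_z = 0"
    "E S_X = S_b" "E S_Y = - S_a"
  shows "E = S_D"
proof
  fix s
  have "s \<in> {s. E s = S_D s}"
    by (rule S_generated)
      (auto simp: subalgebra_def E S_D_gens derivation_add[OF E(1)] derivation_mult[OF E(1)]
        derivation_add[OF derivation_S_D] derivation_mult[OF derivation_S_D])
  then show "E s = S_D s" by simp
qed

lemma subalgebra_kernel: "subalgebra S_const {s. S_D s = 0}"
  by (auto simp: subalgebra_def S_D_gens derivation_add[OF derivation_S_D]
      derivation_mult[OF derivation_S_D])

end

(* Inside C[T] we have a X + b Y = T^2 W with W = X + T Y, and every T^2 W^n is a kernel element.
   Put Y = 0 and z = 1, which is compatible with the relation modulo T^8, and expand elements of S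
   in powers of T with coefficients in C[X]. As R has no element with a nonzero T^1-coefficient,
   D s = 0 forces the T^0-coefficient of s to be constant in X. Hence on the kernel the
   T^2-coefficient is a derivation over scalars, so finitely many kernel elements generate only
   elements whose T^2-coefficient has bounded degree, whereas that of T^2 W^n is X^n. *)
theory Submission
  imports Defs
begin

text \<open>The T^1-coefficient of a product is \<open>x0 * y1 + x1 * y0\<close>, so its vanishing
  passes from the generators to all of R: 1 is a gap of the semigroup generated by 2 and 3.\<close>

lemma coeff_cusp_to_T_1: "coeff (cusp_to_T r) 1 = 0"
proof -
  have "r \<in> {r. coeff (cusp_to_T r) 1 = 0}"
    by (rule cusp_generated)
      (auto simp: subalgebra_def cusp_to_T_gens cusp_to_T_add cusp_to_T_mult coeff_mult)
  then show ?thesis by simp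
qed

lemma coeff_cusp_to_T_add:
  "coeff (cusp_to_T (x + y)) k = coeff (cusp_to_T x) k + coeff (cusp_to_T y) k"
  by (simp add: cusp_to_T_add)

lemma coeff_cusp_to_T_sum: "coeff (cusp_to_T (sum f I)) k = (\<Sum>i\<in>I. coeff (cusp_to_T (f i)) k)"
  by (induction I rule: infinite_finite_induct) (simp_all add: cusp_to_T_0 coeff_cusp_to_T_add)

text \<open>The middle term \<open>x1 * y1\<close> of the T^2-coefficient drops out because of the
  gap at T^1. What remains is a Leibniz rule over the T^0-coefficient.\<close>

lemma coeff_cusp_to_T_mult:
  "coeff (cusp_to_T (x * y)) 0 = coeff (cusp_to_T x) 0 * coeff (cusp_to_T y) 0"
  "coeff (cusp_to_T (x * y)) 2 =
     coeff (cusp_to_T x) 0 * coeff (cusp_to_T y) 2 + coeff (cusp_to_T x) 2 * coeff (cusp_to_T y) 0"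
  using coeff_cusp_to_T_1[of x] by (simp_all add: cusp_to_T_mult coeff_mult numeral_2_eq_2)

definition slice :: "cusp_ring poly poly poly \<Rightarrow> cusp_ring poly" where
  "slice p = poly (poly p 1) 0"

lemma slice_add: "slice (p + q) = slice p + slice q"
  and slice_diff: "slice (p - q) = slice p - slice q"
  and slice_mult: "slice (p * q) = slice p * slice q"
  by (simp_all add: slice_def)

lemma slice_gens:
  "slice (R_const r) = [:r:]" "slice poly_X = [:0, 1:]" "slice poly_Y = 0" "slice poly_Z = 1"
  by (simp_all add: slice_def poly_X_def poly_Y_def poly_Z_def)

lemma slice_S_relator: "slice S_relator = smult (cusp_a ^ 4) (- ([:0, 1:] ^ 2))"
proof -
  have "slice 1 = 1" by (simp add: slice_def)
  then show ?thesis
    by (simp only: S_relator_def power2_eq_square slice_add slice_diff slice_mult slice_gens)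
      (simp add: power4_eq_xxxx)
qed

lemma slice_partial_X: "slice (partial_X p) = pderiv (slice p)"
  unfolding slice_def partial_X_def
  by (induction p)
    (simp_all add: map_poly_pCons pderiv_add poly_0_coeff_0 coeff_map_poly)

definition T_coeff :: "nat \<Rightarrow> cusp_ring poly poly poly \<Rightarrow> complex poly" where
  "T_coeff k p = map_poly (\<lambda>r. coeff (cusp_to_T r) k) (slice p)"

lemma coeff_T_coeff: "coeff (T_coeff k p) n = coeff (cusp_to_T (coeff (slice p) n)) k"
  by (simp add: T_coeff_def coeff_map_poly cusp_to_T_0)

text \<open>The slice of the relator is a multiple of \<open>cusp_a ^ 4\<close>, which is T^8. A
  change of representative therefore affects only the coefficients from T^8 on.\<close>

lemma T_coeff_cong:
  assumes "S_relator dvd p - q" "k < 8" shows "T_coeff k p = T_coeff k q"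
proof (rule poly_eqI)
  fix n
  obtain u where u: "p - q = S_relator * u" using assms(1) by (auto simp: dvd_def)
  define v where "v = - ([:0, 1:] ^ 2) * slice u"
  have "slice p = slice q + smult (cusp_a ^ 4) v"
    using slice_diff[of p q] unfolding u v_def by (simp add: slice_mult slice_S_relator algebra_simps)
  moreover have "coeff (cusp_to_T (cusp_a ^ 4 * r)) k = 0" for r
    using assms(2)
    by (simp add: power4_eq_xxxx cusp_to_T_mult cusp_to_T_gens coeff_monom_mult mult_monom mult.assoc[symmetric])
  ultimately show "coeff (T_coeff k p) n = coeff (T_coeff k q) n"
    by (simp add: coeff_T_coeff cusp_to_T_add)
qed

lift_definition S_coeff0 :: "S_ring \<Rightarrow> complex poly" is "T_coeff 0"
  by (rule T_coeff_cong) simp_all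

lift_definition S_coeff2 :: "S_ring \<Rightarrow> complex poly" is "T_coeff 2"
  by (rule T_coeff_cong) simp_all

lemma T_coeff_add: "T_coeff k (p + q) = T_coeff k p + T_coeff k q"
  by (rule poly_eqI) (simp add: coeff_T_coeff slice_add coeff_cusp_to_T_add)

lemma S_coeff2_add: "S_coeff2 (s + t) = S_coeff2 s + S_coeff2 t"
  by transfer (rule T_coeff_add)

lemma S_coeff0_mult: "S_coeff0 (s * t) = S_coeff0 s * S_coeff0 t"
  by transfer (rule poly_eqI, simp add: coeff_T_coeff slice_mult coeff_mult coeff_cusp_to_T_sum
      coeff_cusp_to_T_mult)

lemma S_coeff2_mult: "S_coeff2 (s * t) = S_coeff0 s * S_coeff2 t + S_coeff2 s * S_coeff0 t"
  by transfer (rule poly_eqI, simp add: coeff_T_coeff slice_mult coeff_mult coeff_cusp_to_T_sum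
      coeff_cusp_to_T_mult sum.distrib)

lemma S_coeff_gens:
  "S_coeff2 (S_const c) = 0" "S_coeff2 S_a = 1"
  "S_coeff0 S_X = [:0, 1:]" "S_coeff2 S_X = 0" "S_coeff0 S_Y = 0" "S_coeff2 S_Y = 0"
  unfolding S_const_def S_a_def
  by (transfer; simp add: T_coeff_def slice_gens map_poly_pCons cusp_to_T_gens cusp_to_T_0 cusp_to_T_1
      one_pCons)+

text \<open>Compare T^3-coefficients in D p. The Y-part, with factor \<open>cusp_a\<close> = T^2,
  contributes a T^1-coefficient, which is 0. The X-part, with factor \<open>cusp_b\<close> = T^3,
  contributes the X-derivative of the T^0-coefficient, which must then vanish.\<close>

lemma pderiv_T_coeff_0:
  assumes "S_relator dvd poly_D p" shows "pderiv (T_coeff 0 p) = 0"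
proof (rule poly_eqI)
  fix n
  \<comment> \<open>The hypothesis gives D p = 0 only modulo the relator; this is enough because 3 <
    8.\<close>
  have D: "T_coeff 3 (poly_D p) = T_coeff 3 0" by (rule T_coeff_cong) (simp_all add: assms)
  define f g where "f = coeff (slice p) (Suc n)" and "g = coeff (slice (partial_Y p)) n"
  have "coeff (slice (poly_D p)) n = of_nat (Suc n) * (cusp_b * f) - cusp_a * g"
    unfolding poly_D_def slice_diff slice_mult slice_gens slice_partial_X f_def g_def
    by (simp add: coeff_pderiv algebra_simps)
  then have eq: "of_nat (Suc n) * (cusp_b * f) = coeff (slice (poly_D p)) n + cusp_a * g"
    by simp
  \<comment> \<open>The integer factor from \<open>pderiv\<close> lies in R; it is moved to C[T],
    where characteristic 0 lets it be cancelled.\<close>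
  have const: "cusp_to_T (of_nat m) = of_nat m" for m
    by (induction m) (simp_all add: cusp_to_T_0 cusp_to_T_1 cusp_to_T_add)
  have "coeff (cusp_to_T (coeff (slice (poly_D p)) n)) 3 = 0"
    using coeff_T_coeff[of 3 "poly_D p" n] coeff_T_coeff[of 3 0 n]
    by (simp add: D slice_def cusp_to_T_0)
  moreover have "coeff (cusp_to_T (cusp_a * g)) 3 = 0"
    using coeff_cusp_to_T_1[of g] by (simp add: cusp_to_T_mult cusp_to_T_gens coeff_monom_mult)
  ultimately have "coeff (cusp_to_T (of_nat (Suc n) * (cusp_b * f))) 3 = 0"
    unfolding eq by (simp add: cusp_to_T_add)
  then have "of_nat (Suc n) * coeff (cusp_to_T f) 0 = 0"
    unfolding cusp_to_T_mult const
    by (simp add: cusp_to_T_gens of_nat_poly coeff_monom_mult del: of_nat_Suc)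
  then show "coeff (pderiv (T_coeff 0 p)) n = coeff 0 n"
    by (simp add: coeff_pderiv coeff_T_coeff f_def)
qed

lemma degree_S_coeff0_kernel: "S_D s = 0 \<Longrightarrow> degree (S_coeff0 s) = 0"
  by (induction s rule: S_ring.abs_induct)
    (simp add: S_coeff0.abs_eq S_D.abs_eq zero_S_ring_def S_ring.abs_eq_iff pderiv_T_coeff_0
      pderiv_eq_0_iff[symmetric])

text \<open>In the Leibniz rule for \<open>S_coeff2\<close> the factors \<open>S_coeff0\<close> have
  degree 0 on the kernel, so degrees do not add up under products.\<close>

lemma subalgebra_bounded_S_coeff2:
  "subalgebra S_const {s. S_D s = 0 \<and> degree (S_coeff2 s) \<le> N}"
proof -
  have "degree (S_coeff2 (s * t)) \<le> N"
    if "S_D s = 0" "S_D t = 0" "degree (S_coeff2 s) \<le> N" "degree (S_coeff2 t) \<le> N" for s t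
    using degree_S_coeff0_kernel[OF that(1)] degree_S_coeff0_kernel[OF that(2)] that(3,4)
    by (auto simp: S_coeff2_mult intro!: degree_add_le order.trans[OF degree_mult_le])
  then show ?thesis
    using subalgebra_kernel by (auto simp: subalgebra_def S_coeff2_add S_coeff_gens intro: degree_add_le)
qed

text \<open>The two components are $T^2 W^n$ and $T^3 W^n$ with $W = X + T Y$.\<close>

fun TW :: "nat \<Rightarrow> S_ring \<times> S_ring" where
  "TW 0 = (S_a, S_b)"
| "TW (Suc n) = (case TW n of (w, v) \<Rightarrow> (S_X * w + S_Y * v, S_X * v + S_Y * (S_a * w)))"

text \<open>T is not in R, so T^2 W^n and T^3 W^n are carried along together, and
  \<open>S_a * w\<close> stands for T^4 W^n. The two relations, which say that the ratio of the
  components is T, are exactly what makes D vanish on the next pair: the values of D are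
  \<open>S_b * w - S_a * v\<close> and \<open>S_b * v - S_a ^ 2 * w\<close>.\<close>

lemma TW_kernel:
  "S_b * fst (TW n) = S_a * snd (TW n) \<and> S_b * snd (TW n) = S_a ^ 2 * fst (TW n) \<and>
   S_D (fst (TW n)) = 0 \<and> S_D (snd (TW n)) = 0"
proof (induction n)
  case 0
  have "S_b ^ 2 = S_a ^ 3"
    by (simp add: S_a_def S_b_def power2_eq_square power3_eq_cube R_to_S_hom[symmetric]
        cusp_relation[unfolded power2_eq_square power3_eq_cube])
  then show ?case by (simp add: S_D_gens power2_eq_square power3_eq_cube mult.commute)
next
  case (Suc n)
  obtain w v where wv: "TW n = (w, v)" by fastforce
  have 1: "S_b * w = S_a * v" and 2: "S_b * v = S_a ^ 2 * w" and 3: "S_D w = 0" "S_D v = 0"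
    using Suc by (simp_all add: wv)
  have "S_b * (S_X * w + S_Y * v) = S_a * (S_X * v + S_Y * (S_a * w))"
  proof -
    have "S_b * (S_X * w + S_Y * v) = S_X * (S_b * w) + S_Y * (S_b * v)"
      by (simp add: algebra_simps)
    then show ?thesis unfolding 1 2 by (simp add: algebra_simps power2_eq_square)
  qed
  moreover have "S_b * (S_X * v + S_Y * (S_a * w)) = S_a ^ 2 * (S_X * w + S_Y * v)"
  proof -
    have "S_b * (S_X * v + S_Y * (S_a * w)) = S_X * (S_b * v) + S_Y * S_a * (S_b * w)"
      by (simp add: algebra_simps)
    then show ?thesis unfolding 1 2 by (simp add: algebra_simps power2_eq_square)
  qed
  moreover have "S_D (S_X * w + S_Y * v) = 0" "S_D (S_X * v + S_Y * (S_a * w)) = 0"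
    using 1 2
    by (simp_all add: derivation_add[OF derivation_S_D] derivation_mult[OF derivation_S_D] S_D_gens 3
        power2_eq_square)
  ultimately show ?case by (simp add: wv)
qed

text \<open>Both \<open>S_coeff0\<close> and \<open>S_coeff2\<close> kill \<open>S_Y\<close>, so
  each step of the recursion just multiplies the T^2-coefficient by X, starting from 1.\<close>

lemma degree_S_coeff2_TW: "degree (S_coeff2 (fst (TW n))) = n"
proof -
  have "S_coeff2 (fst (TW n)) = monom 1 n"
  proof (induction n)
    case 0
    then show ?case by (simp add: S_coeff_gens)
  next
    case (Suc n)
    then show ?case
      by (simp add: S_coeff2_add S_coeff2_mult S_coeff_gens monom_Suc case_prod_unfold)
  qed
  then show ?thesis by (simp add: degree_monom_eq)
qed

theorem proposition2p3:
  shows "\<not> finitely_generated_algebra S_const {s. S_D s = 0}"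
proof
  assume "finitely_generated_algebra S_const {s. S_D s = 0}"
  then obtain G where G: "finite G" "G \<subseteq> {s. S_D s = 0}" "{s. S_D s = 0} = subalgebra S_const hull G"
    by (auto simp: finitely_generated_algebra_def)
  obtain N where N: "\<forall>g\<in>G. degree (S_coeff2 g) \<le> N"
    using finite_nat_set_iff_bounded_le[of "(\<lambda>g. degree (S_coeff2 g)) ` G"] G(1) by auto
  have "subalgebra S_const hull G \<subseteq> {s. S_D s = 0 \<and> degree (S_coeff2 s) \<le> N}"
    using G(2) N by (intro hull_minimal subalgebra_bounded_S_coeff2) auto
  \<comment> \<open>The index is chosen so that the T^2-coefficient has degree one above the
    bound.\<close>
  moreover have "fst (TW (Suc N)) \<in> subalgebra S_const hull G"
    using TW_kernel[of "Suc N"] unfolding G(3)[symmetric] by blast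
  ultimately show False
    using degree_S_coeff2_TW[of "Suc N"] by auto
qed

end
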